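(* Fix integers $d\ge1$ and $n>d$. Let $a=(a_1,\dots,a_{n-1})\in[0,1]^{n-1}$ be a global minimizer of the level-$n$ weak-peek problem, i.e. of $L^{\mathrm{wp}}_{d,n}$ over $[0,1]^{n-1}$. Suppose that $a_k=0$ for some $d\le k<n$. Then $$R_d=U_{d,k}(a_1,\dots,a_{k-1}).$$ In particular, the corresponding level-$k$ truncated strategy $(\tfrac12,a_1,\dots,a_{k-1},0,0,\dots)$ is optimal for the distance-$d$ oblivious self-distance rendezvous problem (its expected rendezvous time equals $R_d$).
   Context: Model. An admissible strategy is a sequence $a=(a_i)_{i\ge 0}$ with $a_i\in[0,1]$ and $a_0=\tfrac12$; $\mathcal A$ is the set of admissible strategies. Extend $a$ to a signed sequence $(b_i)_{i\in\mathbb Z}$ by $b_i=a_i$ for $i\ge0$ and $b_i=1-a_{-i}$ for $i<0$. Two independent Markov chains $(X_t)_{t\ge0},(Y_t)_{t\ge 0}$ on $\mathbb Z$ start at $X_0=Y_0=0$; each moves from $k$ to $k+1$ with probability $b_k$ and to $k-1$ with probability $1-b_k$. For an integer $d\ge1$ the rendezvous time is $\mathcal T_d(a)=\inf\{t\ge0: X_t=Y_t+2d\}$, and $R_d=\inf_{a\in\mathcal A}\mathbb E[\mathcal T_d(a)]$. Truncated chain. Fix $d\ge1$, $n\ge d$ and $a=(a_1,\dots,a_{n-1})\in[0,1]^{n-1}$. Set $a_0=\frac12$, $a_i=0$ for $i\ge n$, and let $b_i=a_i$ for $i\ge0$ and $b_i=1-a_{-i}$ for $i<0$. The level-$n$ truncated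 chain has states $S_{x,y}$ with $-n\le x,y\le n$, $x-y\le 2d$, $x-y$ even; states with $x-y=2d$ are absorbing; from any other state $S_{x,y}$ the two coordinates move independently, $x\mapsto x+1$ with probability $b_x$ and $x\mapsto x-1$ with probability $1-b_x$, and $y\mapsto y+1$ with probability $b_y$ and $y\mapsto y-1$ with probability $1-b_y$. $U_{d,n}(a)\in[0,\infty]$ is the expected hitting time of the absorbing set starting from $S_{0,0}$ ($\infty$ if not finite). Weak-peek chain. Fix $d\ge1$, $n\ge d$, $a=(a_1,\dots,a_{n-1})\in[0,1]^{n-1}$, set $a_0=\frac12$, and for $|i|<n$ let $b_i=a_i$ if $0\le i<n$ and $b_i=1-a_{-i}$ if $-n<i<0$. The level-$n$ weak-peek chain has states $S_{i,j}$ with $-n\le i\le n+2d$, $-n-2d\le j\le n$, $i-j\le 2d$, $i-j$ even; states with $i-j=2d$ are absorbing. From any other state $S_{i,j}$ the two coordinates move independently: the first moves to $i+1$ with probability $1$ if $|i|\ge n$, and otherwise to $i+1$ with probability $b_i$ and to $i-1$ with probability $1-b_i$; the second moves to $j-1$ with probability $1$ if $|j|\ge n$, and otherwise to $j+1$ with probability $b_j$ and to $j-1$ with probability $1-b_j$. $L^{\mathrm{wp}}_{d,n}(a)\in[0,\infty]$ is the expected hitting time of the absorbing set starting from $S_{0,0}$. *)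

theory Defs
  imports "HOL-Probability.Probability"
begin

section \<open>Path measures of time-homogeneous Markov chains\<close>

definition chain_kernel :: "('s \<Rightarrow> 's pmf) \<Rightarrow> 's \<Rightarrow> nat \<Rightarrow> (nat \<Rightarrow> 's) \<Rightarrow> 's measure" where
  "chain_kernel K s t \<omega> =
     (case t of 0 \<Rightarrow> measure_pmf (return_pmf s) | Suc u \<Rightarrow> measure_pmf (K (\<omega> u)))"

interpretation chain: Ionescu_Tulcea "chain_kernel K s" "\<lambda>_. count_space UNIV"
  for K :: "'s \<Rightarrow> 's pmf" and s :: 's
proof (rule Ionescu_Tulcea.intro)
  fix t :: nat
  let ?S = "subprob_algebra (count_space (UNIV :: 's set))"
  have K: "(\<lambda>x. measure_pmf (L x)) \<in> count_space UNIV \<rightarrow>\<^sub>M ?S" for L :: "'s \<Rightarrow> 's pmf"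
    by (simp add: measure_pmf_in_subprob_algebra)
  show "chain_kernel K s t \<in> PiM {0..<t} (\<lambda>_. count_space UNIV) \<rightarrow>\<^sub>M ?S"
  proof (cases t)
    case 0
    then show ?thesis
      by (simp add: chain_kernel_def[abs_def] measure_pmf_in_subprob_algebra)
  next
    case (Suc u)
    have "(\<lambda>\<omega>. \<omega> u) \<in> PiM {0..<t} (\<lambda>_. count_space (UNIV :: 's set)) \<rightarrow>\<^sub>M count_space UNIV"
      using Suc by (intro measurable_component_singleton) simp
    from measurable_compose[OF this K[of K]] show ?thesis
      by (simp add: chain_kernel_def[abs_def] Suc)
  qed
next
  fix t :: nat and \<omega> :: "nat \<Rightarrow> 's"
  show "prob_space (chain_kernel K s t \<omega>)"
    by (simp add: chain_kernel_def prob_space_measure_pmf split: nat.split)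
qed

definition chain_measure :: "('s \<Rightarrow> 's pmf) \<Rightarrow> 's \<Rightarrow> (nat \<Rightarrow> 's) measure" where
  "chain_measure K s = chain.PF.lim K s"

lemma sets_chain_measure [measurable_cong]:
  "sets (chain_measure K s) = sets (PiM UNIV (\<lambda>_. count_space UNIV))"
  by (simp add: chain_measure_def)

lemma space_chain_measure [simp]: "space (chain_measure K s) = UNIV"
  using sets_eq_imp_space_eq[OF sets_chain_measure, of K s] by (simp add: space_PiM)

lemma emeasure_chain_C:
  "emeasure (chain.C K s 0 n (\<lambda>_. undefined)) {restrict x {0..<n}} =
     (\<Prod>t<n. ennreal (pmf (case t of 0 \<Rightarrow> return_pmf s | Suc u \<Rightarrow> K (x u)) (x t)))"
proof (induction n)
  case 0
  then show ?case
    by (simp add: space_PiM PiM_empty emeasure_return restrict_def)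
next
  case (Suc n)
  let ?N = "\<lambda>n. PiM {0..<n} (\<lambda>_. count_space (UNIV :: 'a set))"
  let ?C = "chain.C K s 0 n (\<lambda>_. undefined)"
  let ?q = "ennreal (pmf (case n of 0 \<Rightarrow> return_pmf s | Suc u \<Rightarrow> K (x u)) (x n))"
  have sing: "{restrict x {0..<m}} \<in> sets (?N m)" for m
  proof -
    have "{restrict x {0..<m}} = PiE {0..<m} (\<lambda>t. {x t})"
      by (auto simp: PiE_iff extensional_def fun_eq_iff)
    also have "\<dots> \<in> sets (?N m)"
      by (intro sets_PiM_I_finite) auto
    finally show ?thesis .
  qed
  have u: "(\<lambda>_. undefined) \<in> space (?N 0)"
    by (auto simp: space_PiM)
  have eP: "emeasure (chain.eP K s n \<omega>) {restrict x {0..<Suc n}} =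
      ?q * indicator {restrict x {0..<n}} \<omega>" if \<omega>: "\<omega> \<in> space (?N n)" for \<omega>
  proof -
    have eq: "fun_upd \<omega> n y = restrict x {0..<Suc n} \<longleftrightarrow> \<omega> = restrict x {0..<n} \<and> y = x n" for y
    proof
      assume h: "fun_upd \<omega> n y = restrict x {0..<Suc n}"
      have "\<omega> t = restrict x {0..<n} t" for t
        using fun_cong[OF h, of t] \<omega>
        by (cases "t = n") (auto simp: space_PiM PiE_iff extensional_def less_Suc_eq split: if_splits)
      moreover have "y = x n" using fun_cong[OF h, of n] by simp
      ultimately show "\<omega> = restrict x {0..<n} \<and> y = x n" by auto
    qed (auto simp: fun_eq_iff less_Suc_eq)
    have "emeasure (chain.eP K s n \<omega>) {restrict x {0..<Suc n}} =
        emeasure (chain_kernel K s n \<omega>)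
          ((\<lambda>y. fun_upd \<omega> n y) -` {restrict x {0..<Suc n}} \<inter> space (count_space UNIV))"
      by (rule chain.emeasure_eP[OF \<omega> sing])
    also have "(\<lambda>y. fun_upd \<omega> n y) -` {restrict x {0..<Suc n}} \<inter> space (count_space UNIV) =
        (if \<omega> = restrict x {0..<n} then {x n} else {})"
      using eq by auto
    also have "emeasure (chain_kernel K s n \<omega>) \<dots> = ?q * indicator {restrict x {0..<n}} \<omega>"
      by (auto simp: chain_kernel_def emeasure_pmf_single split: nat.split)
    finally show ?thesis .
  qed
  have "emeasure (chain.C K s 0 (Suc n) (\<lambda>_. undefined)) {restrict x {0..<Suc n}} =
      (\<integral>\<^sup>+ \<omega>. emeasure (chain.eP K s n \<omega>) {restrict x {0..<Suc n}} \<partial>?C)"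
    using chain.measurable_eP[of K s n] prob_space.not_empty[OF chain.prob_space_C[OF u, of K s n]]
    by (simp add: emeasure_bind[OF _ _ sing] measurable_cong_sets[OF chain.sets_C[OF u] refl])
  also have "\<dots> = (\<integral>\<^sup>+ \<omega>. ?q * indicator {restrict x {0..<n}} \<omega> \<partial>?C)"
    by (intro nn_integral_cong eP) (simp add: chain.space_C[OF u])
  also have "\<dots> = ?q * emeasure ?C {restrict x {0..<n}}"
    using sing by (intro nn_integral_cmult_indicator) (simp add: chain.sets_C[OF u])
  finally show ?case
    by (simp only: Suc.IH prod.lessThan_Suc mult.commute)
qed

lemma chain_measure_cylinder:
  "emeasure (chain_measure K s) {\<omega>. \<forall>t\<le>n. \<omega> t = x t} =
    ennreal ((if x 0 = s then 1 else 0) * (\<Prod>t<n. pmf (K (x t)) (x (Suc t))))"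
proof -
  let ?J = "{0..<Suc n}"
  let ?X = "{restrict x ?J}"
  have X: "?X \<in> sets (PiM ?J (\<lambda>_. count_space (UNIV :: 'a set)))"
  proof -
    have "?X = PiE ?J (\<lambda>t. {x t})"
      by (auto simp: PiE_iff extensional_def fun_eq_iff)
    also have "\<dots> \<in> sets (PiM ?J (\<lambda>_. count_space (UNIV :: 'a set)))"
      by (intro sets_PiM_I_finite) auto
    finally show ?thesis .
  qed
  have 1: "{\<omega>. \<forall>t\<le>n. \<omega> t = x t} = prod_emb UNIV (\<lambda>_. count_space UNIV) ?J ?X"
    by (auto simp: prod_emb_def space_PiM fun_eq_iff restrict_def less_Suc_eq_le) metis
  have 2: "prod_emb ?J (\<lambda>_. count_space UNIV) ?J ?X = ?X"
    by (rule prod_emb_id) (auto simp: space_PiM)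
  have "emeasure (chain_measure K s) {\<omega>. \<forall>t\<le>n. \<omega> t = x t} =
      (\<Prod>t<Suc n. ennreal (pmf (case t of 0 \<Rightarrow> return_pmf s | Suc u \<Rightarrow> K (x u)) (x t)))"
    unfolding chain_measure_def 1
    by (subst chain.lim[OF _ X])
       (simp_all only: finite_atLeastLessThan chain.emeasure_CI[OF order_refl X] 2 emeasure_chain_C)
  also have "\<dots> = ennreal ((if x 0 = s then 1 else 0) * (\<Prod>t<n. pmf (K (x t)) (x (Suc t))))"
    by (subst prod.lessThan_Suc_shift) (auto simp: prod_ennreal ennreal_mult prod_nonneg)
  finally show ?thesis .
qed

lemma prob_space_chain_measure: "prob_space (chain_measure K s)"
proof -
  have "prob_space (distr (chain_measure K s) (PiM {} (\<lambda>_. count_space UNIV)) (\<lambda>\<omega>. restrict \<omega> {}))"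
    unfolding chain_measure_def chain.distr_lim[OF finite.emptyI]
    by (rule chain.PF.prob_space_P) auto
  then show ?thesis
    by (rule prob_space_distrD[rotated])
       (auto intro!: measurable_restrict simp: measurable_cong_sets[OF sets_chain_measure refl])
qed

text \<open>As the infimum of the empty set is \<open>\<infinity>\<close>, a path that avoids \<open>A\<close> has hitting time \<open>\<infinity>\<close>.\<close>

definition hitting_time :: "'s set \<Rightarrow> (nat \<Rightarrow> 's) \<Rightarrow> ennreal" where
  "hitting_time A \<omega> = (INF t\<in>{t. \<omega> t \<in> A}. of_nat t)"

definition expected_hitting_time :: "('s \<Rightarrow> 's pmf) \<Rightarrow> 's \<Rightarrow> 's set \<Rightarrow> ennreal" where
  "expected_hitting_time K s A = (\<integral>\<^sup>+ \<omega>. hitting_time A \<omega> \<partial>chain_measure K s)"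


section \<open>Strategies and rendezvous\<close>

definition strategies :: "(nat \<Rightarrow> real) set" where
  "strategies = {a. a 0 = 1 / 2 \<and> (\<forall>i. a i \<in> {0..1})}"

definition signed_seq :: "(nat \<Rightarrow> real) \<Rightarrow> int \<Rightarrow> real" where
  "signed_seq a i = (if 0 \<le> i then a (nat i) else 1 - a (nat (- i)))"

definition walk_step :: "real \<Rightarrow> int \<Rightarrow> int pmf" where
  "walk_step p k = map_pmf (\<lambda>up. if up then k + 1 else k - 1) (bernoulli_pmf p)"

definition walk_kernel :: "(nat \<Rightarrow> real) \<Rightarrow> int \<Rightarrow> int pmf" where
  "walk_kernel a k = walk_step (signed_seq a k) k"

definition rendezvous_time :: "nat \<Rightarrow> (nat \<Rightarrow> int) \<Rightarrow> (nat \<Rightarrow> int) \<Rightarrow> ennreal" where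
  "rendezvous_time d X Y = (INF t\<in>{t. X t = Y t + 2 * int d}. of_nat t)"

definition expected_rendezvous_time :: "nat \<Rightarrow> (nat \<Rightarrow> real) \<Rightarrow> ennreal" where
  "expected_rendezvous_time d a =
     (\<integral>\<^sup>+ \<omega>. rendezvous_time d (fst \<omega>) (snd \<omega>)
        \<partial>(chain_measure (walk_kernel a) 0 \<Otimes>\<^sub>M chain_measure (walk_kernel a) 0))"

definition rendezvous_value :: "nat \<Rightarrow> ennreal" where
  "rendezvous_value d = (INF a\<in>strategies. expected_rendezvous_time d a)"


section \<open>The level-\<open>n\<close> chains\<close>

text \<open>
  A parameter vector \<open>(a\<^sub>1, \<dots>, a\<^sub>n\<^sub>-\<^sub>1)\<close> is a function on \<open>{1..<n}\<close>; the notions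
  below only read a function \<open>a :: nat \<Rightarrow> real\<close> at these indices, so a longer vector
  stands for its initial segment.
\<close>

definition param_cube :: "nat \<Rightarrow> (nat \<Rightarrow> real) set" where
  "param_cube n = {1..<n} \<rightarrow>\<^sub>E {0..1}"

definition truncated_strategy :: "nat \<Rightarrow> (nat \<Rightarrow> real) \<Rightarrow> nat \<Rightarrow> real" where
  "truncated_strategy n a i = (if i = 0 then 1 / 2 else if i < n then a i else 0)"

definition meeting_set :: "nat \<Rightarrow> (int \<times> int) set" where
  "meeting_set d = {(x, y). x - y = 2 * int d}"

text \<open>
  The kernels are written on all of \<open>int \<times> int\<close>; the chains live on the state sets
  below, which contain the initial state and are closed under the respective kernel.
\<close>

definition truncated_kernel :: "nat \<Rightarrow> nat \<Rightarrow> (nat \<Rightarrow> real) \<Rightarrow> int \<times> int \<Rightarrow> (int \<times> int) pmf" where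
  "truncated_kernel d n a = (\<lambda>(x, y).
     if (x, y) \<in> meeting_set d then return_pmf (x, y)
     else pair_pmf (walk_kernel (truncated_strategy n a) x) (walk_kernel (truncated_strategy n a) y))"

definition truncated_states :: "nat \<Rightarrow> nat \<Rightarrow> (int \<times> int) set" where
  "truncated_states d n = {(x, y). - int n \<le> x \<and> x \<le> int n \<and> - int n \<le> y \<and> y \<le> int n \<and>
     x - y \<le> 2 * int d \<and> even (x - y)}"

definition truncated_time :: "nat \<Rightarrow> nat \<Rightarrow> (nat \<Rightarrow> real) \<Rightarrow> ennreal" where
  "truncated_time d n a = expected_hitting_time (truncated_kernel d n a) (0, 0)
     (truncated_states d n \<inter> meeting_set d)"

definition weak_peek_kernel :: "nat \<Rightarrow> nat \<Rightarrow> (nat \<Rightarrow> real) \<Rightarrow> int \<times> int \<Rightarrow> (int \<times> int) pmf" where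
  "weak_peek_kernel d n a = (\<lambda>(i, j).
     if (i, j) \<in> meeting_set d then return_pmf (i, j)
     else pair_pmf
       (if \<bar>i\<bar> \<ge> int n then return_pmf (i + 1) else walk_kernel (a(0 := 1 / 2)) i)
       (if \<bar>j\<bar> \<ge> int n then return_pmf (j - 1) else walk_kernel (a(0 := 1 / 2)) j))"

definition weak_peek_states :: "nat \<Rightarrow> nat \<Rightarrow> (int \<times> int) set" where
  "weak_peek_states d n = {(i, j). - int n \<le> i \<and> i \<le> int n + 2 * int d \<and>
     - int n - 2 * int d \<le> j \<and> j \<le> int n \<and> i - j \<le> 2 * int d \<and> even (i - j)}"

definition weak_peek_time :: "nat \<Rightarrow> nat \<Rightarrow> (nat \<Rightarrow> real) \<Rightarrow> ennreal" where
  "weak_peek_time d n a = expected_hitting_time (weak_peek_kernel d n a) (0, 0)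
     (weak_peek_states d n \<inter> meeting_set d)"

lemma set_walk_step: "set_pmf (walk_step p k) \<subseteq> {k + 1, k - 1}"
  by (auto simp: walk_step_def)

lemma walk_step_0: "walk_step 0 k = return_pmf (k - 1)"
proof -
  have "bernoulli_pmf 0 = return_pmf False"
    by (rule pmf_eqI) (auto simp: pmf.rep_eq[symmetric] split: split_indicator bool.split)
  then show ?thesis by (simp add: walk_step_def)
qed

lemma walk_step_1: "walk_step 1 k = return_pmf (k + 1)"
proof -
  have "bernoulli_pmf 1 = return_pmf True"
    by (rule pmf_eqI) (auto split: split_indicator)
  then show ?thesis by (simp add: walk_step_def)
qed

lemma set_walk_kernel: "set_pmf (walk_kernel a k) \<subseteq> {k + 1, k - 1}"
  using set_walk_step by (simp add: walk_kernel_def)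

lemma set_walk_kernel_truncated:
  assumes "1 \<le> n" "- int n \<le> k" "k \<le> int n" "k' \<in> set_pmf (walk_kernel (truncated_strategy n a) k)"
  shows "- int n \<le> k' \<and> k' \<le> int n \<and> (k' = k + 1 \<or> k' = k - 1)"
proof -
  have *: "k' = k + 1 \<or> k' = k - 1"
    using assms(4) set_walk_kernel by blast
  consider "k = int n" | "k = - int n" | "- int n < k" "k < int n"
    using assms by linarith
  then show ?thesis
    using assms * by cases (auto simp: walk_kernel_def signed_seq_def truncated_strategy_def walk_step_0 walk_step_1)
qed

lemma truncated_states_closed:
  assumes "1 \<le> d" "d \<le> n" "s \<in> truncated_states d n" "s' \<in> set_pmf (truncated_kernel d n a s)"
  shows "s' \<in> truncated_states d n"
proof -
  obtain x y x' y' where s: "s = (x, y)" "s' = (x', y')"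
    by (metis surj_pair)
  show ?thesis
  proof (cases "s \<in> meeting_set d")
    case True
    then show ?thesis using assms s by (auto simp: truncated_kernel_def)
  next
    case False
    then have "x' \<in> set_pmf (walk_kernel (truncated_strategy n a) x)"
        "y' \<in> set_pmf (walk_kernel (truncated_strategy n a) y)"
      using assms s by (auto simp: truncated_kernel_def)
    from set_walk_kernel_truncated[OF _ _ _ this(1)] set_walk_kernel_truncated[OF _ _ _ this(2)]
    have *: "- int n \<le> x' \<and> x' \<le> int n \<and> (x' = x + 1 \<or> x' = x - 1)"
        "- int n \<le> y' \<and> y' \<le> int n \<and> (y' = y + 1 \<or> y' = y - 1)"
      using assms s by (auto simp: truncated_states_def)
    have "x - y \<le> 2 * int d" "x - y \<noteq> 2 * int d" "even (x - y)"
      using assms(3) False s by (auto simp: truncated_states_def meeting_set_def)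
    then have "x' - y' \<le> 2 * int d \<and> even (x' - y')"
      using * by presburger
    then show ?thesis using * s by (auto simp: truncated_states_def)
  qed
qed

lemma weak_peek_states_closed:
  assumes "1 \<le> d" "d \<le> n" "s \<in> weak_peek_states d n" "s' \<in> set_pmf (weak_peek_kernel d n a s)"
  shows "s' \<in> weak_peek_states d n"
proof -
  obtain x y x' y' where s: "s = (x, y)" "s' = (x', y')"
    by (metis surj_pair)
  show ?thesis
  proof (cases "s \<in> meeting_set d")
    case True
    then show ?thesis using assms s by (auto simp: weak_peek_kernel_def)
  next
    case False
    then have "x' \<in> set_pmf (if \<bar>x\<bar> \<ge> int n then return_pmf (x + 1) else walk_kernel (a(0 := 1 / 2)) x)"
        "y' \<in> set_pmf (if \<bar>y\<bar> \<ge> int n then return_pmf (y - 1) else walk_kernel (a(0 := 1 / 2)) y)"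
      using assms s by (auto simp: weak_peek_kernel_def)
    then have *: "x' = x + 1 \<or> x' = x - 1 \<and> \<bar>x\<bar> < int n" "y' = y - 1 \<or> y' = y + 1 \<and> \<bar>y\<bar> < int n"
      using set_walk_kernel by (fastforce split: if_splits)+
    have 1: "x - y \<le> 2 * int d" "x - y \<noteq> 2 * int d" "even (x - y)"
        "- int n \<le> x" "y \<le> int n"
      using assms(3) False s by (auto simp: weak_peek_states_def meeting_set_def)
    then have 2: "x - y \<le> 2 * int d - 2"
      by presburger
    have 3: "even (x' - y')"
      using * 1(3) by presburger
    have "- int n \<le> x'" "y' \<le> int n" "x' - y' \<le> 2 * int d"
      using * 1 2 by linarith+
    moreover have "x' \<le> int n + 2 * int d" "- int n - 2 * int d \<le> y'"
      using * 1 2 by linarith+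
    ultimately show ?thesis using 3 s by (auto simp: weak_peek_states_def)
  qed
qed

end

theory Submission
  imports Defs
begin

text \<open>
  For every admissible strategy the weak-peek time of its initial segment is at most its expected
  rendezvous time: the weak-peek walk differs only by being forced forward outside the window, and
  for nearest-neighbour walks being further forward (by an even distance) can only shorten the time
  to meet. Hence the minimal weak-peek time is at most the rendezvous value. If \<open>a k = 0\<close>, then
  both walks of the weak-peek chain are trapped in \<open>[-k, k]\<close> and never feel the forcing, so that
  the minimal weak-peek time is attained by an admissible strategy, the level-\<open>k\<close> truncation.
\<close>

section \<open>Finite path laws and survival probabilities\<close>

text \<open>Lists over a countable state type are countable, so laws of finite paths can be compared
  list by list.\<close>

primrec path_pmf :: "('s \<Rightarrow> 's pmf) \<Rightarrow> nat \<Rightarrow> 's \<Rightarrow> 's list pmf" where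
  "path_pmf K 0 s = return_pmf [s]"
| "path_pmf K (Suc n) s = bind_pmf (K s) (\<lambda>y. map_pmf ((#) s) (path_pmf K n y))"

text \<open>The tail \<open>P(T > n)\<close> of the hitting time \<open>T\<close> of
  \<open>A\<close>. The recursion never looks beyond a visit to \<open>A\<close>, so its value is
  independent of how the kernel acts inside \<open>A\<close>.\<close>

primrec survival :: "('s \<Rightarrow> 's pmf) \<Rightarrow> 's set \<Rightarrow> nat \<Rightarrow> 's \<Rightarrow> ennreal" where
  "survival K A 0 s = indicator (- A) s"
| "survival K A (Suc n) s = indicator (- A) s * (\<integral>\<^sup>+ y. survival K A n y \<partial>K s)"

abbreviation pair_kernel :: "('s \<Rightarrow> 's pmf) \<Rightarrow> ('t \<Rightarrow> 't pmf) \<Rightarrow> 's \<times> 't \<Rightarrow> ('s \<times> 't) pmf" where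
  "pair_kernel K L \<equiv> \<lambda>(x, y). pair_pmf (K x) (L y)"

lemma set_path_pmfD:
  assumes "xs \<in> set_pmf (path_pmf K n s)"
  shows "length xs = Suc n" "xs ! 0 = s"
  using assms by (induction n arbitrary: s xs) auto

text \<open>The same product as in \<open>chain_measure_cylinder\<close>; matching the two
  identifies the law of an initial segment.\<close>

lemma pmf_path_pmf:
  assumes "length xs = Suc n"
  shows "pmf (path_pmf K n s) xs =
    (if xs ! 0 = s then 1 else 0) * (\<Prod>t<n. pmf (K (xs ! t)) (xs ! Suc t))"
  using assms
proof (induction n arbitrary: s xs)
  case 0
  then obtain x where "xs = [x]" by (cases xs) auto
  then show ?case by simp
next
  case (Suc n)
  then obtain x xs' where xs: "xs = x # xs'" and len: "length xs' = Suc n"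
    by (cases xs) auto
  have map: "pmf (map_pmf ((#) s) p) (x # xs') = (if x = s then pmf p xs' else 0)" for p
  proof (cases "x = s")
    case True
    have "inj ((#) s)" by simp
    then show ?thesis using True pmf_map_inj'[of "(#) s" p xs'] by simp
  qed (auto simp: pmf_eq_0_set_pmf)
  have "pmf (path_pmf K (Suc n) s) xs =
      measure_pmf.expectation (K s) (\<lambda>y. (if x = s then pmf (path_pmf K n y) xs' else 0))"
    by (simp add: xs pmf_bind map)
  \<comment> \<open>Only \<open>y = xs' ! 0\<close> contributes, so the expectation collapses to one
    transition probability.\<close>
  also have "\<dots> = measure_pmf.expectation (K s) (\<lambda>y.
      indicator {xs' ! 0} y * ((if x = s then 1 else 0) *
        (\<Prod>t<n. pmf (K (xs' ! t)) (xs' ! Suc t))))"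
    by (intro Bochner_Integration.integral_cong refl) (simp add: Suc.IH[OF len])
  also have "\<dots> = pmf (K s) (xs' ! 0) * ((if x = s then 1 else 0) *
        (\<Prod>t<n. pmf (K (xs' ! t)) (xs' ! Suc t)))"
    by (simp add: pmf.rep_eq)
  also have "\<dots> = (if xs ! 0 = s then 1 else 0) *
        (\<Prod>t<Suc n. pmf (K (xs ! t)) (xs ! Suc t))"
    unfolding prod.lessThan_Suc_shift by (simp add: xs)
  finally show ?case .
qed

section \<open>Initial segments of infinite paths\<close>

lemma measurable_initial_segment:
  "(\<lambda>\<omega>. map \<omega> [0..<Suc n]) \<in> chain_measure K s \<rightarrow>\<^sub>M count_space (UNIV :: 's :: countable list set)"
proof (subst measurable_count_space_eq2_countable, intro conjI ballI)
  fix xs :: "'s list"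
  have "(\<lambda>\<omega>. map \<omega> [0..<Suc n]) -` {xs} \<inter> space (chain_measure K s) =
      {\<omega> \<in> space (chain_measure K s). length xs = Suc n \<and> (\<forall>t\<le>n. \<omega> t = xs ! t)}"
    by (auto simp: list_eq_iff_nth_eq less_Suc_eq_le simp del: upt_Suc)
  also have "\<dots> \<in> sets (chain_measure K s)"
    by measurable
  finally show "(\<lambda>\<omega>. map \<omega> [0..<Suc n]) -` {xs} \<inter> space (chain_measure K s) \<in> sets (chain_measure K s)" .
qed auto

text \<open>Both sides live on a countable set of lists, so point masses decide: lists of length
  \<open>n + 1\<close> give cylinder probabilities, all others have mass zero.\<close>

lemma distr_initial_segment:
  fixes s :: "'s :: countable"
  shows "distr (chain_measure K s) (count_space UNIV) (\<lambda>\<omega>. map \<omega> [0..<Suc n]) =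
    measure_pmf (path_pmf K n s)"
proof (rule measure_eqI_countable[where A = UNIV])
  fix xs :: "'s list"
  show "emeasure (distr (chain_measure K s) (count_space UNIV) (\<lambda>\<omega>. map \<omega> [0..<Suc n])) {xs} =
    emeasure (measure_pmf (path_pmf K n s)) {xs}"
  proof (cases "length xs = Suc n")
    case True
    then have "(\<lambda>\<omega>. map \<omega> [0..<Suc n]) -` {xs} = {\<omega>. \<forall>t\<le>n. \<omega> t = xs ! t}"
      by (auto simp: list_eq_iff_nth_eq less_Suc_eq_le simp del: upt_Suc)
    then show ?thesis
      using True by (simp add: emeasure_distr[OF measurable_initial_segment] chain_measure_cylinder
          emeasure_pmf_single pmf_path_pmf del: upt_Suc)
  next
    case False
    then have "(\<lambda>\<omega>. map \<omega> [0..<Suc n]) -` {xs} = {}" "xs \<notin> set_pmf (path_pmf K n s)"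
      using set_path_pmfD(1)[of xs K n s] by (auto simp del: upt_Suc)
    then show ?thesis
      by (simp add: emeasure_distr[OF measurable_initial_segment] emeasure_pmf_single
          pmf_eq_0_set_pmf del: upt_Suc)
  qed
qed auto

lemma nn_integral_initial_segment:
  fixes s :: "'s :: countable"
  shows "(\<integral>\<^sup>+ \<omega>. f (map \<omega> [0..<Suc n]) \<partial>chain_measure K s) = (\<integral>\<^sup>+ xs. f xs \<partial>path_pmf K n s)"
  by (subst distr_initial_segment[symmetric], subst nn_integral_distr)
     (auto intro: measurable_initial_segment simp del: upt_Suc)

lemma all_initial_segment: "(\<forall>t\<le>n. P (\<omega> t)) \<longleftrightarrow> list_all P (map \<omega> [0..<Suc n])"
  by (auto simp: list_all_iff less_Suc_eq_le simp del: upt_Suc)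

lemma all2_initial_segment:
  "(\<forall>t\<le>n. P (\<omega> t) (\<eta> t)) \<longleftrightarrow> list_all2 P (map \<omega> [0..<Suc n]) (map \<eta> [0..<Suc n])"
  by (auto simp: list_all2_conv_all_nth less_Suc_eq_le simp del: upt_Suc)

lemma nn_integral_path_pmf_avoid:
  "(\<integral>\<^sup>+ xs. of_bool (list_all (\<lambda>x. x \<notin> A) xs) \<partial>path_pmf K n s) = survival K A n s"
proof (induction n arbitrary: s)
  case (Suc n)
  then show ?case
    by (cases "s \<in> A") (simp_all add: nn_integral_bind_pmf)
qed (simp add: indicator_def)

text \<open>Both iterated integrals are the integral over the independent pair, whose components
  \<open>pair_commute_pmf\<close> exchanges.\<close>

lemma nn_integral_swap_pmf:
  "(\<integral>\<^sup>+ x. \<integral>\<^sup>+ y. f x y \<partial>measure_pmf q \<partial>measure_pmf p) =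
   (\<integral>\<^sup>+ y. \<integral>\<^sup>+ x. f x y \<partial>measure_pmf p \<partial>measure_pmf q)"
proof -
  have "(\<integral>\<^sup>+ x. \<integral>\<^sup>+ y. f x y \<partial>measure_pmf q \<partial>measure_pmf p) =
      (\<integral>\<^sup>+ z. f (fst z) (snd z) \<partial>pair_pmf p q)"
    by (simp add: nn_integral_pair_pmf')
  also have "\<dots> = (\<integral>\<^sup>+ y. \<integral>\<^sup>+ x. f x y \<partial>measure_pmf p \<partial>measure_pmf q)"
    by (subst pair_commute_pmf) (simp add: nn_integral_pair_pmf' case_prod_unfold)
  finally show ?thesis .
qed

text \<open>Two independent paths may be revealed in lockstep, which turns them into one path of the
  pair chain.\<close>

lemma nn_integral_path_pmf_avoid2:
  "(\<integral>\<^sup>+ xs. \<integral>\<^sup>+ ys. of_bool (list_all2 (\<lambda>x y. (x, y) \<notin> A) xs ys) \<partial>path_pmf L n y \<partial>path_pmf K n x) =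
    survival (pair_kernel K L) A n (x, y)"
proof (induction n arbitrary: x y)
  case (Suc n)
  show ?case
  proof (cases "(x, y) \<in> A")
    case False
    have "(\<integral>\<^sup>+ xs. \<integral>\<^sup>+ ys. of_bool (list_all2 (\<lambda>x y. (x, y) \<notin> A) xs ys)
          \<partial>path_pmf L (Suc n) y \<partial>path_pmf K (Suc n) x) =
        (\<integral>\<^sup>+ x'. \<integral>\<^sup>+ xs. \<integral>\<^sup>+ y'. \<integral>\<^sup>+ ys. of_bool (list_all2 (\<lambda>x y. (x, y) \<notin> A) xs ys)
          \<partial>path_pmf L n y' \<partial>L y \<partial>path_pmf K n x' \<partial>K x)"
      using False by (simp add: nn_integral_bind_pmf)
    \<comment> \<open>Draw the second walk's next position before the rest of the first path; both
      remaining paths then start from drawn points and the induction hypothesis applies.\<close>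
    also have "\<dots> = (\<integral>\<^sup>+ x'. \<integral>\<^sup>+ y'. survival (pair_kernel K L) A n (x', y') \<partial>L y \<partial>K x)"
      by (subst nn_integral_swap_pmf) (simp add: Suc.IH)
    finally show ?thesis
      using False by (simp add: nn_integral_pair_pmf')
  qed (simp add: nn_integral_bind_pmf)
qed (simp add: indicator_def)

section \<open>Expected times as sums of tails\<close>

text \<open>A natural number \<open>m\<close> is the sum of the indicators of \<open>n < m\<close>,
  here with \<open>m\<close> the least element of \<open>S\<close>. For empty \<open>S\<close> every
  term is 1 and both sides are infinite.\<close>

lemma INF_of_nat_eq_suminf:
  "(INF t\<in>S. of_nat t :: ennreal) = (\<Sum>n. of_bool (\<forall>t\<le>n. t \<notin> S))"
proof (cases "S = {}")
  case True
  have "(\<Sum>n::nat. 1 :: ennreal) = \<infinity>"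
    by (simp add: suminf_eq_SUP ennreal_SUP_of_nat_eq_top)
  then show ?thesis using True by simp
next
  case False
  define m where "m = (LEAST t. t \<in> S)"
  have m: "m \<in> S" using False unfolding m_def by (metis LeastI all_not_in_conv)
  have m_le: "m \<le> t" if "t \<in> S" for t using that unfolding m_def by (rule Least_le)
  have eq: "(\<forall>t\<le>n. t \<notin> S) \<longleftrightarrow> n < m" for n
    using m m_le by (meson le_trans leI leD)
  have "(INF t\<in>S. of_nat t :: ennreal) = of_nat m"
    using m m_le by (intro antisym INF_lower INF_greatest) auto
  also have "\<dots> = (\<Sum>n. of_bool (n < m))"
    by (subst suminf_finite[of "{..<m}"]) auto
  finally show ?thesis by (simp add: eq)
qed

text \<open>\<open>E T\<close> is the sum of the tails \<open>P(T > n)\<close>, and each tail event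
  depends only on an initial segment.\<close>

lemma expected_hitting_time_eq_suminf:
  fixes s :: "'s :: countable"
  shows "expected_hitting_time K s A = (\<Sum>n. survival K A n s)"
proof -
  have "expected_hitting_time K s A =
      (\<integral>\<^sup>+ \<omega>. (\<Sum>n. of_bool (list_all (\<lambda>x. x \<notin> A) (map \<omega> [0..<Suc n]))) \<partial>chain_measure K s)"
    by (simp add: expected_hitting_time_def hitting_time_def INF_of_nat_eq_suminf
        all_initial_segment[of _ "\<lambda>x. x \<notin> A"] del: upt_Suc)
  also have "\<dots> = (\<Sum>n. \<integral>\<^sup>+ \<omega>. of_bool (list_all (\<lambda>x. x \<notin> A) (map \<omega> [0..<Suc n])) \<partial>chain_measure K s)"
    by (intro nn_integral_suminf measurable_compose[OF measurable_initial_segment]) simp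
  finally show ?thesis
    by (simp only: nn_integral_initial_segment[where f = "\<lambda>xs. of_bool (list_all (\<lambda>x. x \<notin> A) xs)"]
        nn_integral_path_pmf_avoid)
qed

text \<open>Tonelli on the product of the path measures, then revealing both paths in lockstep,
  gives the tail sum of one pair chain. Its kernel is not stopped at a meeting, which
  \<open>survival\<close> does not see.\<close>

lemma expected_rendezvous_time_eq_suminf:
  "expected_rendezvous_time d a =
    (\<Sum>n. survival (pair_kernel (walk_kernel a) (walk_kernel a)) (meeting_set d) n (0, 0))"
proof -
  let ?M = "chain_measure (walk_kernel a) 0"
  let ?g = "\<lambda>xs ys. of_bool (list_all2 (\<lambda>x y. (x, y) \<notin> meeting_set d) xs ys) :: ennreal"
  interpret M: prob_space ?M by (rule prob_space_chain_measure)
  have meas: "(\<lambda>\<omega>. ?g (map (fst \<omega>) [0..<Suc n]) (map (snd \<omega>) [0..<Suc n])) \<in> borel_measurable (?M \<Otimes>\<^sub>M ?M)" for n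
    unfolding all2_initial_segment[symmetric] meeting_set_def
    by measurable
  have "expected_rendezvous_time d a = (\<integral>\<^sup>+ \<omega>. (\<Sum>n. ?g (map (fst \<omega>) [0..<Suc n]) (map (snd \<omega>) [0..<Suc n])) \<partial>(?M \<Otimes>\<^sub>M ?M))"
    unfolding expected_rendezvous_time_def rendezvous_time_def INF_of_nat_eq_suminf
      all2_initial_segment[symmetric]
    by (simp add: meeting_set_def algebra_simps)
  also have "\<dots> = (\<Sum>n. \<integral>\<^sup>+ \<omega>. ?g (map (fst \<omega>) [0..<Suc n]) (map (snd \<omega>) [0..<Suc n]) \<partial>(?M \<Otimes>\<^sub>M ?M))"
    by (intro nn_integral_suminf meas)
  also have "\<dots> = (\<Sum>n. \<integral>\<^sup>+ \<omega>. \<integral>\<^sup>+ \<eta>. ?g (map \<omega> [0..<Suc n]) (map \<eta> [0..<Suc n]) \<partial>?M \<partial>?M)"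
    by (subst M.nn_integral_fst[OF meas, symmetric]) (simp del: upt_Suc)
  also have "\<dots> = (\<Sum>n. \<integral>\<^sup>+ xs. \<integral>\<^sup>+ ys. ?g xs ys \<partial>measure_pmf (path_pmf (walk_kernel a) n 0) \<partial>measure_pmf (path_pmf (walk_kernel a) n 0))"
    by (simp only: nn_integral_initial_segment[where f = "\<lambda>ys. ?g xs ys" for xs]
        nn_integral_initial_segment[where f = "\<lambda>xs. \<integral>\<^sup>+ ys. ?g xs ys \<partial>N" for N])
  finally show ?thesis by (simp only: nn_integral_path_pmf_avoid2)
qed

section \<open>Comparison of survival probabilities\<close>

text \<open>Until the target is hit the path stays in \<open>C\<close>; hence only the kernel on
  \<open>C - A\<close> and the trace of the target on \<open>C\<close> enter.\<close>

lemma survival_cong: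
  assumes "\<And>s. s \<in> C - A \<Longrightarrow> K s = L s" "\<And>s. s \<in> C - A \<Longrightarrow> set_pmf (K s) \<subseteq> C"
    and "A \<inter> C = B \<inter> C" "s \<in> C"
  shows "survival K A n s = survival L B n s"
  using \<open>s \<in> C\<close>
proof (induction n arbitrary: s)
  case 0
  then show ?case using assms(3) by (auto simp: indicator_def)
next
  case (Suc n)
  show ?case
  proof (cases "s \<in> A")
    case True
    then show ?thesis using assms(3) Suc.prems by (auto simp: indicator_def)
  next
    case False
    then have s: "s \<in> C - A" "s \<notin> B" using assms(3) Suc.prems by auto
    have "(\<integral>\<^sup>+ y. survival K A n y \<partial>K s) = (\<integral>\<^sup>+ y. survival L B n y \<partial>K s)"
      using assms(2)[OF s(1)] by (intro nn_integral_cong_AE) (auto simp: AE_measure_pmf_iff Suc.IH)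
    then show ?thesis using s assms(1)[OF s(1)] by simp
  qed
qed

lemma nn_integral_walk_step:
  assumes "0 \<le> p" "p \<le> 1"
  shows "(\<integral>\<^sup>+ x. f x \<partial>walk_step p k) = f (k + 1) * ennreal p + f (k - 1) * ennreal (1 - p)"
  using assms by (simp add: walk_step_def)

text \<open>Shifting weight \<open>q - p\<close> from \<open>v\<close> to the smaller
  \<open>u\<close> lowers the average. Only the real weights are subtracted, since \<open>u\<close>
  and \<open>v\<close> may be infinite.\<close>

lemma convex_comb_mono_ennreal:
  fixes u v :: ennreal
  assumes "0 \<le> p" "p \<le> q" "q \<le> 1" "u \<le> v"
  shows "u * ennreal q + v * ennreal (1 - q) \<le> u * ennreal p + v * ennreal (1 - p)"
proof -
  have "u * ennreal q + v * ennreal (1 - q) = u * ennreal p + u * ennreal (q - p) + v * ennreal (1 - q)"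
    using assms by (simp add: distrib_left[symmetric] ennreal_plus[symmetric] del: ennreal_plus)
  also have "\<dots> \<le> u * ennreal p + v * ennreal (q - p) + v * ennreal (1 - q)"
    using assms by (intro add_mono mult_right_mono) auto
  also have "\<dots> = u * ennreal p + v * ennreal (1 - p)"
    using assms by (simp add: add.assoc distrib_left[symmetric] ennreal_plus[symmetric] del: ennreal_plus)
  finally show ?thesis .
qed

lemma nn_integral_walk_step_antimono:
  assumes "0 \<le> p" "p \<le> q" "q \<le> 1" "f (k + 1) \<le> f (k - 1)"
  shows "(\<integral>\<^sup>+ x. f x \<partial>walk_step q k) \<le> (\<integral>\<^sup>+ x. f x \<partial>walk_step p k)"
  using assms by (simp add: nn_integral_walk_step convex_comb_mono_ennreal)

lemma nn_integral_walk_step_mono: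
  assumes "0 \<le> p" "p \<le> q" "q \<le> 1" "f (k - 1) \<le> f (k + 1)"
  shows "(\<integral>\<^sup>+ x. f x \<partial>walk_step p k) \<le> (\<integral>\<^sup>+ x. f x \<partial>walk_step q k)"
  using convex_comb_mono_ennreal[of "1 - q" "1 - p" "f (k - 1)" "f (k + 1)"] assms
  by (simp add: nn_integral_walk_step add.commute)

text \<open>Two separate step functions, because the forcing raises the first walk's up-probability
  and lowers the second's.\<close>

abbreviation steps_kernel :: "(int \<Rightarrow> real) \<Rightarrow> (int \<Rightarrow> real) \<Rightarrow> int \<times> int \<Rightarrow> (int \<times> int) pmf" where
  "steps_kernel p q \<equiv> pair_kernel (\<lambda>x. walk_step (p x) x) (\<lambda>y. walk_step (q y) y)"

text \<open>
  Unit steps from points at distance two cannot cross, so an advance of two is never reversed.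
\<close>

lemma survival_steps_mono:
  assumes p: "\<And>x. 0 \<le> p x \<and> p x \<le> 1" and q: "\<And>y. 0 \<le> q y \<and> q y \<le> 1"
  shows "survival (steps_kernel p q) {(x, y). c \<le> x - y} n (x + 1, y) \<le>
           survival (steps_kernel p q) {(x, y). c \<le> x - y} n (x - 1, y)"
    and "survival (steps_kernel p q) {(x, y). c \<le> x - y} n (x, y - 1) \<le>
           survival (steps_kernel p q) {(x, y). c \<le> x - y} n (x, y + 1)"
proof (induction n arbitrary: x y)
  case 0
  { case 1 show ?case by (simp add: indicator_def) next
    case 2 show ?case by (simp add: indicator_def) }
next
  case (Suc n)
  define S where "S = survival (steps_kernel p q) {(x, y). c \<le> x - y} n"
  \<comment> \<open>Averaging over one walk's step leaves a function that is still monotone in the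
    other walk's position, so the coordinates can be treated one at a time.\<close>
  define G where "G x y = (\<integral>\<^sup>+ y'. S (x, y') \<partial>walk_step (q y) y)" for x y
  define H where "H x y = (\<integral>\<^sup>+ x'. S (x', y) \<partial>walk_step (p x) x)" for x y
  have G: "G (k + 1) y \<le> G (k - 1) y" for k y
    unfolding G_def S_def by (intro nn_integral_mono Suc.IH)
  have H: "H x (k - 1) \<le> H x (k + 1)" for x k
    unfolding H_def S_def by (intro nn_integral_mono Suc.IH)
  have int_G: "survival (steps_kernel p q) {(x, y). c \<le> x - y} (Suc n) (x, y) =
      indicator (- {(x, y). c \<le> x - y}) (x, y) * (\<integral>\<^sup>+ x'. G x' y \<partial>walk_step (p x) x)" for x y
    by (simp add: G_def S_def nn_integral_pair_pmf')
  have int_H: "survival (steps_kernel p q) {(x, y). c \<le> x - y} (Suc n) (x, y) =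
      indicator (- {(x, y). c \<le> x - y}) (x, y) * (\<integral>\<^sup>+ y'. H x y' \<partial>walk_step (q y) y)" for x y
    unfolding H_def S_def
    by (subst nn_integral_swap_pmf) (simp add: nn_integral_pair_pmf')
  { case 1
    \<comment> \<open>The worst step from \<open>x + 1\<close> and the best step from
      \<open>x - 1\<close> both end at \<open>x\<close>, whatever the up-probabilities there
      are.\<close>
    have "(\<integral>\<^sup>+ x'. G x' y \<partial>walk_step (p (x + 1)) (x + 1)) \<le> (\<integral>\<^sup>+ x'. G x' y \<partial>walk_step 0 (x + 1))"
      using p by (intro nn_integral_walk_step_antimono[where f = "\<lambda>x'. G x' y"] G) auto
    also have "\<dots> = (\<integral>\<^sup>+ x'. G x' y \<partial>walk_step 1 (x - 1))"
      by (simp add: walk_step_0 walk_step_1)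
    also have "\<dots> \<le> (\<integral>\<^sup>+ x'. G x' y \<partial>walk_step (p (x - 1)) (x - 1))"
      using p by (intro nn_integral_walk_step_antimono[where f = "\<lambda>x'. G x' y"] G) auto
    finally show ?case
      unfolding int_G by (intro mult_mono) (auto simp: indicator_def)
  next
    case 2
    \<comment> \<open>For the second walk downward is forward: the worst step from
      \<open>y - 1\<close> and the best step from \<open>y + 1\<close> both end at
      \<open>y\<close>.\<close>
    have "(\<integral>\<^sup>+ y'. H x y' \<partial>walk_step (q (y - 1)) (y - 1)) \<le> (\<integral>\<^sup>+ y'. H x y' \<partial>walk_step 1 (y - 1))"
      using q by (intro nn_integral_walk_step_mono[where f = "H x"] H) auto
    also have "\<dots> = (\<integral>\<^sup>+ y'. H x y' \<partial>walk_step 0 (y + 1))"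
      by (simp add: walk_step_0 walk_step_1)
    also have "\<dots> \<le> (\<integral>\<^sup>+ y'. H x y' \<partial>walk_step (q (y + 1)) (y + 1))"
      using q by (intro nn_integral_walk_step_mono[where f = "H x"] H) auto
    finally show ?case
      unfolding int_H by (intro mult_mono) (auto simp: indicator_def) }
qed

text \<open>Induction on time: the current step is slowed down one walk at a time under the survival
  function of the faster chain, whose monotonicity fixes the sign; the induction hypothesis then
  slows down the later steps.\<close>

lemma survival_steps_le:
  assumes p: "\<And>x. 0 \<le> p x \<and> p x \<le> p' x \<and> p' x \<le> 1"
    and q: "\<And>y. 0 \<le> q' y \<and> q' y \<le> q y \<and> q y \<le> 1"
  shows "survival (steps_kernel p' q') {(x, y). c \<le> x - y} n s \<le>
    survival (steps_kernel p q) {(x, y). c \<le> x - y} n s"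
proof (induction n arbitrary: s)
  case (Suc n)
  obtain x y where s: "s = (x, y)" by (cases s)
  let ?S' = "survival (steps_kernel p' q') {(x, y). c \<le> x - y} n"
  have p': "0 \<le> p' x \<and> p' x \<le> 1" for x using p[of x] by auto
  have q': "0 \<le> q' x \<and> q' x \<le> 1" for x using q[of x] by auto
  note mono = survival_steps_mono[where p = p' and q = q', OF p' q']
  have "(\<integral>\<^sup>+ x'. \<integral>\<^sup>+ y'. ?S' (x', y') \<partial>walk_step (q' y) y \<partial>walk_step (p' x) x) \<le>
      (\<integral>\<^sup>+ x'. \<integral>\<^sup>+ y'. ?S' (x', y') \<partial>walk_step (q' y) y \<partial>walk_step (p x) x)"
    using p by (intro nn_integral_walk_step_antimono nn_integral_mono mono) auto
  also have "\<dots> \<le> (\<integral>\<^sup>+ x'. \<integral>\<^sup>+ y'. ?S' (x', y') \<partial>walk_step (q y) y \<partial>walk_step (p x) x)"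
    using q by (intro nn_integral_mono nn_integral_walk_step_mono mono) auto
  also have "\<dots> \<le> (\<integral>\<^sup>+ x'. \<integral>\<^sup>+ y'. survival (steps_kernel p q) {(x, y). c \<le> x - y} n (x', y')
      \<partial>walk_step (q y) y \<partial>walk_step (p x) x)"
    by (intro nn_integral_mono Suc.IH)
  finally show ?case
    by (simp add: s nn_integral_pair_pmf' mult_left_mono)
qed simp

section \<open>Weak-peek, truncated and free walks\<close>

lemma signed_seq_unit_interval:
  assumes "a \<in> strategies"
  shows "0 \<le> signed_seq a i \<and> signed_seq a i \<le> 1"
  using assms by (auto simp: signed_seq_def strategies_def)

text \<open>Both times are tail sums for a \<open>steps_kernel\<close> with a half-plane target, and
  \<open>survival_steps_le\<close> compares them term by term.\<close>

lemma weak_peek_time_le_expected_rendezvous_time: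
  assumes "1 \<le> d" "d \<le> n" "a \<in> strategies"
  shows "weak_peek_time d n (restrict a {1..<n}) \<le> expected_rendezvous_time d a"
proof -
  define p where "p i = (if int n \<le> \<bar>i\<bar> then 1 else signed_seq a i)" for i
  define q where "q i = (if int n \<le> \<bar>i\<bar> then 0 else signed_seq a i)" for i
  \<comment> \<open>The monotonicity argument uses a half-plane instead of the line
    \<open>x - y = 2 * int d\<close>, so that a pair already beyond the line counts as met.\<close>
  let ?H = "{(x, y). 2 * int d \<le> x - y}"
  let ?C = "{(x, y). x - y \<le> 2 * int d \<and> even (x - y)}"
  have unit: "0 \<le> signed_seq a i \<and> signed_seq a i \<le> 1" for i
    by (rule signed_seq_unit_interval[OF assms(3)])
  \<comment> \<open>Restriction loses index 0; the update restores it because admissibility gives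
    \<open>a 0 = 1 / 2\<close>.\<close>
  have "((restrict a {1..<n})(0 := 1 / 2)) m = a m" if "m < n" for m
    using assms(3) that by (auto simp: strategies_def)
  then have walk: "walk_kernel ((restrict a {1..<n})(0 := 1 / 2)) i = walk_step (signed_seq a i) i"
    if "\<bar>i\<bar> < int n" for i
    using that by (simp add: walk_kernel_def signed_seq_def del: fun_upd_apply restrict_apply restrict_upd)
  have kernel: "weak_peek_kernel d n (restrict a {1..<n}) s = steps_kernel p q s"
    if "s \<notin> meeting_set d" for s
    using that
    by (auto simp: weak_peek_kernel_def p_def q_def walk walk_step_0 walk_step_1
        simp del: restrict_upd One_nat_def split: prod.split)
  \<comment> \<open>Off the meeting set an even difference in \<open>?C\<close> is at most
    \<open>2 * int d - 2\<close>, and one joint step adds at most 2, so \<open>2 * int d\<close>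
    cannot be jumped over.\<close>
  have closed: "set_pmf (steps_kernel f g s) \<subseteq> ?C" if "s \<in> ?C - meeting_set d" for s f g
  proof -
    obtain x y where s: "s = (x, y)" by (cases s)
    have even: "u \<le> 2 * int d - 2" if "u \<le> 2 * int d" "u \<noteq> 2 * int d" "even u" for u
      using that by presburger
    have "x - y \<le> 2 * int d - 2" "even (x - y)"
      using even[of "x - y"] that unfolding s meeting_set_def by simp_all
    then have "x' - y' \<le> 2 * int d \<and> even (x' - y')"
      if "x' \<in> {x + 1, x - 1}" "y' \<in> {y + 1, y - 1}" for x' y'
      using that by auto
    then have "set_pmf (walk_step (f x) x) \<times> set_pmf (walk_step (g y) y) \<subseteq> ?C"
      using set_walk_step[of "f x" x] set_walk_step[of "g y" y] by blast
    then show ?thesis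
      unfolding s by simp
  qed
  let ?K = "weak_peek_kernel d n (restrict a {1..<n})" and ?S = "weak_peek_states d n"
  have H: "meeting_set d \<inter> ?C = ?H \<inter> ?C"
    by (auto simp: meeting_set_def)
  have wp: "survival ?K (?S \<inter> meeting_set d) t (0, 0) = survival (steps_kernel p q) ?H t (0, 0)" for t
  proof -
    \<comment> \<open>Two passes: closedness of \<open>?S\<close> removes it from the target, then
      closedness of \<open>?C\<close> replaces the absorbing kernel and the line by
      \<open>steps_kernel\<close> and the half-plane.\<close>
    have "survival ?K (?S \<inter> meeting_set d) t (0, 0) = survival ?K (meeting_set d) t (0, 0)"
    proof (rule survival_cong[where C = ?S])
      show "set_pmf (?K s) \<subseteq> ?S" if "s \<in> ?S - ?S \<inter> meeting_set d" for s
        using weak_peek_states_closed[OF assms(1,2)] that by blast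
    qed (auto simp: weak_peek_states_def)
    also have "\<dots> = survival (steps_kernel p q) ?H t (0, 0)"
    proof (rule survival_cong[where C = ?C])
      show "?K s = steps_kernel p q s" if "s \<in> ?C - meeting_set d" for s
        using that by (intro kernel) blast
      then show "set_pmf (?K s) \<subseteq> ?C" if "s \<in> ?C - meeting_set d" for s
        using closed[OF that, of p q] that by simp
    qed (use H in auto)
    finally show ?thesis .
  qed
  have "survival (pair_kernel (walk_kernel a) (walk_kernel a)) (meeting_set d) t (0, 0) =
      survival (steps_kernel (signed_seq a) (signed_seq a)) ?H t (0, 0)" for t
    unfolding walk_kernel_def
    by (rule survival_cong[where C = ?C]) (use closed H in auto)
  moreover have "survival (steps_kernel p q) ?H t (0, 0) \<le>
      survival (steps_kernel (signed_seq a) (signed_seq a)) ?H t (0, 0)" for t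
    by (rule survival_steps_le) (use unit in \<open>auto simp: p_def q_def\<close>)
  ultimately show ?thesis
    unfolding weak_peek_time_def expected_hitting_time_eq_suminf expected_rendezvous_time_eq_suminf wp
    by (simp add: suminf_le)
qed

text \<open>The default value 0 from index \<open>n\<close> on reflects the walks inward at
  \<open>n\<close> and \<open>-n\<close>, so the free walks stay in the window and differ from the
  truncated chain only after meeting.\<close>

lemma truncated_time_eq_expected_rendezvous_time:
  assumes "1 \<le> d" "d \<le> n"
  shows "truncated_time d n a = expected_rendezvous_time d (truncated_strategy n a)"
  unfolding truncated_time_def expected_hitting_time_eq_suminf expected_rendezvous_time_eq_suminf
proof (intro suminf_cong survival_cong[where C = "truncated_states d n"])
  show "set_pmf (truncated_kernel d n a s) \<subseteq> truncated_states d n"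
    if "s \<in> truncated_states d n - truncated_states d n \<inter> meeting_set d" for s
    using truncated_states_closed[OF assms] that by blast
qed (auto simp: truncated_states_def truncated_kernel_def)

text \<open>\<open>a k = 0\<close> reflects both walks at \<open>k\<close> and \<open>-k\<close>; as
  \<open>k < n\<close>, the forced positions are never reached.\<close>

lemma weak_peek_time_eq_truncated_time:
  assumes "1 \<le> d" "d \<le> k" "k < n" "a k = 0"
  shows "weak_peek_time d n a = truncated_time d k a"
proof -
  have walk: "walk_kernel (a(0 := 1 / 2)) i = walk_kernel (truncated_strategy k a) i"
    if "- int k \<le> i" "i \<le> int k" for i
  proof -
    \<comment> \<open>Agreement includes the boundary index \<open>m = k\<close>, where
      \<open>a k = 0\<close> equals the default value of the truncation.\<close>
    have "(a(0 := 1 / 2)) m = truncated_strategy k a m" if "m \<le> k" for m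
      using that assms by (auto simp: truncated_strategy_def)
    then show ?thesis using that by (simp add: walk_kernel_def signed_seq_def del: fun_upd_apply)
  qed
  have kernel: "weak_peek_kernel d n a s = truncated_kernel d k a s" if "s \<in> truncated_states d k" for s
    using that assms(3) walk by (auto simp: weak_peek_kernel_def truncated_kernel_def truncated_states_def)
  have sub: "truncated_states d k \<subseteq> weak_peek_states d n"
    using assms(3) by (auto simp: truncated_states_def weak_peek_states_def)
  show ?thesis
    unfolding weak_peek_time_def truncated_time_def expected_hitting_time_eq_suminf
  proof (intro suminf_cong survival_cong[where C = "truncated_states d k"])
    show "weak_peek_kernel d n a s = truncated_kernel d k a s"
      if "s \<in> truncated_states d k - weak_peek_states d n \<inter> meeting_set d" for s
      using that by (intro kernel) blast
    then show "set_pmf (weak_peek_kernel d n a s) \<subseteq> truncated_states d k"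
      if "s \<in> truncated_states d k - weak_peek_states d n \<inter> meeting_set d" for s
      using truncated_states_closed[OF assms(1,2)] that by fastforce
    show "weak_peek_states d n \<inter> meeting_set d \<inter> truncated_states d k =
        truncated_states d k \<inter> meeting_set d \<inter> truncated_states d k"
      using sub by blast
  qed (simp add: truncated_states_def)
qed

theorem lemma6:
  fixes d n k :: nat and a :: "nat \<Rightarrow> real"
  assumes "1 \<le> d" and "d < n"
    and "is_arg_min (weak_peek_time d n) (\<lambda>a'. a' \<in> param_cube n) a"
    and "d \<le> k" and "k < n" and "a k = 0"
  shows "rendezvous_value d = truncated_time d k a \<and>
    truncated_strategy k a \<in> strategies \<and>
    expected_rendezvous_time d (truncated_strategy k a) = rendezvous_value d"
proof -
  have a: "a \<in> param_cube n"
    using assms(3) by (simp add: is_arg_min_def)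
  have min: "weak_peek_time d n a \<le> weak_peek_time d n a'" if "a' \<in> param_cube n" for a'
    using assms(3) that by (auto simp: is_arg_min_def not_less)
  have strat: "truncated_strategy k a \<in> strategies"
    using a assms(5) by (auto simp: truncated_strategy_def strategies_def param_cube_def PiE_iff)
  have trunc: "truncated_time d k a = expected_rendezvous_time d (truncated_strategy k a)"
    using assms by (intro truncated_time_eq_expected_rendezvous_time)
  have "truncated_time d k a \<le> expected_rendezvous_time d a'" if "a' \<in> strategies" for a'
  proof -
    \<comment> \<open>Members of \<open>param_cube n\<close> are extensional, so a competing
      strategy enters through its restriction.\<close>
    have "restrict a' {1..<n} \<in> param_cube n"
      using that by (auto simp: param_cube_def strategies_def)
    then have "weak_peek_time d n a \<le> weak_peek_time d n (restrict a' {1..<n})"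
      by (rule min)
    also have "\<dots> \<le> expected_rendezvous_time d a'"
      using assms that by (intro weak_peek_time_le_expected_rendezvous_time) auto
    finally show ?thesis
      using weak_peek_time_eq_truncated_time[of d k n a] assms by simp
  qed
  \<comment> \<open>The lower bound is attained by the admissible truncated strategy, so the infimum
    is a minimum.\<close>
  then have "rendezvous_value d = truncated_time d k a"
    unfolding rendezvous_value_def trunc
    by (intro antisym INF_lower INF_greatest strat) auto
  with strat trunc show ?thesis by simp
qed

end
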